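(* Let $k$ be a positive integer. For every integer $n\geqslant\lceil k^2/2+2k+1\rceil$ there exists a $k$-prolific permutation $\sigma\in S_n$.
   Context: $S_n$ is the set of permutations of $[n]$. A permutation $\sigma\in S_n$ contains $\pi\in S_r$ ($\pi\preceq\sigma$) if there are indices $i_1<\dots<i_r$ with $\sigma(i_1)\cdots\sigma(i_r)$ in the same relative order as $\pi$; for $n>k\geqslant1$, $\sigma$ is $k$-prolific if $|\{\pi\in S_{n-k}:\pi\preceq\sigma\}|=\binom{n}{k}$. *)

theory Defs
  imports Complex_Main "HOL-Combinatorics.Permutations"
begin

text \<open>
  The symmetric group on \<open>[n]\<close> is rendered as the functions \<open>\<sigma>\<close> with \<open>\<sigma> permutes {1..n}\<close>.
  These are the identity outside \<open>{1..n}\<close>, so counting such functions counts permutations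
  of \<open>[n]\<close>.
\<close>

text \<open>
  The strictly increasing map \<open>f\<close> lists the indices \<open>i\<^sub>1 < \<dots> < i\<^sub>r\<close> of an occurrence
  of \<open>\<pi>\<close> (of length \<open>r\<close>) in \<open>\<sigma>\<close> (of length \<open>n\<close>).
\<close>

definition contains_pattern ::
  "nat \<Rightarrow> (nat \<Rightarrow> nat) \<Rightarrow> nat \<Rightarrow> (nat \<Rightarrow> nat) \<Rightarrow> bool" where
  "contains_pattern n \<sigma> r \<pi> \<longleftrightarrow>
     (\<exists>f. strict_mono_on {1..r} f \<and> f ` {1..r} \<subseteq> {1..n} \<and>
          (\<forall>i\<in>{1..r}. \<forall>j\<in>{1..r}. \<sigma> (f i) < \<sigma> (f j) \<longleftrightarrow> \<pi> i < \<pi> j))"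

definition prolific :: "nat \<Rightarrow> nat \<Rightarrow> (nat \<Rightarrow> nat) \<Rightarrow> bool" where
  "prolific k n \<sigma> \<longleftrightarrow>
     1 \<le> k \<and> k < n \<and> \<sigma> permutes {1..n} \<and>
     card {\<pi>. \<pi> permutes {1..n - k} \<and> contains_pattern n \<sigma> (n - k) \<pi>} = n choose k"

end

theory Submission
  imports Defs
begin

text \<open>
  If any two points of the graph of \<open>\<sigma>\<close> are at taxicab distance at least \<open>k + 2\<close>, then \<open>\<sigma>\<close> is
  \<open>k\<close>-prolific. Suppose deleting the \<open>k\<close>-sets \<open>A \<noteq> B\<close> gives the same pattern, and let \<open>\<phi>\<close> be the order
  isomorphism between the survivors. By symmetry some point moves to the north-east. A monotone
  fixed point argument yields \<open>u, v \<in> A - B\<close> moving north-east such that \<open>u\<close> is the leftmost such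
  point below \<open>\<phi> v\<close> and \<open>v\<close> the lowest such point to the left of \<open>\<phi> u\<close>. The horizontal
  displacement of \<open>u\<close> and the vertical displacement of \<open>v\<close> span a box; counting deleted points shows
  that their sum is at most \<open>k\<close> plus the number of points of \<open>A\<close> in the box, which is impossible
  for points at mutual distance at least \<open>k + 2\<close>.

  A permutation of length \<open>n\<close> with minimal distance \<open>d = k + 2\<close> is obtained with \<open>e = d div 2\<close> by
  listing the residue classes modulo \<open>2 * e + 1\<close> in the order \<open>e, 0, e + 1, 1, \<dots>, e - 1, 2 * e\<close>,
  each class in decreasing order.
\<close>

section \<open>Order isomorphisms between complements\<close>

lemma card_split_le:
  fixes X :: "'a \<Rightarrow> int"
  assumes "finite A" "s \<le> t"
  shows "card {a\<in>A. X a \<le> t} = card {a\<in>A. X a \<le> s} + card {a\<in>A. s < X a \<and> X a \<le> t}"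
proof -
  have "{a\<in>A. X a \<le> t} = {a\<in>A. X a \<le> s} \<union> {a\<in>A. s < X a \<and> X a \<le> t}"
    using assms by auto
  then show ?thesis
    using assms by (simp add: card_Un_disjoint disjoint_iff)
qed

lemma card_bij_le:
  fixes X :: "'a \<Rightarrow> int"
  assumes "bij_betw X V {1..int n}" "0 \<le> t" "t \<le> int n"
  shows "int (card {v\<in>V. X v \<le> t}) = t"
proof -
  have "bij_betw X {v\<in>V. X v \<le> t} {1..t}"
    unfolding bij_betw_def
  proof
    show "inj_on X {v\<in>V. X v \<le> t}"
      using assms(1) by (auto simp: bij_betw_def inj_on_def)
    show "X ` {v\<in>V. X v \<le> t} = {1..t}"
    proof
      show "X ` {v\<in>V. X v \<le> t} \<subseteq> {1..t}"
        using assms(1) by (auto simp: bij_betw_def)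
      show "{1..t} \<subseteq> X ` {v\<in>V. X v \<le> t}"
      proof
        fix s assume s: "s \<in> {1..t}"
        then have "s \<in> X ` V"
          using assms by (auto simp: bij_betw_def)
        then show "s \<in> X ` {v\<in>V. X v \<le> t}"
          using s by auto
      qed
    qed
  qed
  then show ?thesis
    using assms(2) by (simp add: bij_betw_same_card)
qed

text \<open>A point and its image have equally many survivors weakly to their left
  (\<open>rank_eq\<close>), so the displacement of \<open>u\<close> is the number of points of
  \<open>A\<close> up to \<open>X (\<phi> u)\<close> minus the number of points of \<open>B\<close>
  up to \<open>X u\<close>. Starting both counts at a level where \<open>A\<close> does not
  outnumber \<open>B\<close> can only enlarge this difference.\<close>

lemma displacement_le:
  fixes X :: "'a \<Rightarrow> int"
  assumes X: "bij_betw X V {1..int n}" and AB: "A \<subseteq> V" "B \<subseteq> V"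
    and \<phi>: "bij_betw \<phi> (V - B) (V - A)"
    and mono: "\<And>p q. p \<in> V - B \<Longrightarrow> q \<in> V - B \<Longrightarrow> X p < X q \<Longrightarrow> X (\<phi> p) < X (\<phi> q)"
    and u: "u \<in> V - B" "X u < X (\<phi> u)"
  shows "X (\<phi> u) - X u \<le>
    int (card {a\<in>A - B. X a < X (\<phi> a) \<and> X a < X (\<phi> u)}) +
    int (card {c\<in>A \<inter> B. X u < X c \<and> X c < X (\<phi> u)})"
proof -
  have fV: "finite V"
    using X bij_betw_finite by fastforce
  have fin: "finite A" "finite B"
    using AB fV finite_subset by auto
  have rng: "1 \<le> X p \<and> X p \<le> int n" if "p \<in> V" for p
    using X that unfolding bij_betw_def by auto
  have inj: "X p = X q \<Longrightarrow> p = q" if "p \<in> V" "q \<in> V" for p q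
    using X that unfolding bij_betw_def inj_on_def by auto
  have \<phi>V: "\<phi> p \<in> V - A" if "p \<in> V - B" for p
    using \<phi> that by (auto simp: bij_betw_def)
  have le_iff: "X (\<phi> p) \<le> X (\<phi> q) \<longleftrightarrow> X p \<le> X q" if "p \<in> V - B" "q \<in> V - B" for p q
    using mono[of p q] mono[of q p] that inj[of p q]
    by (cases "X p" "X q" rule: linorder_cases) auto
  define NA where "NA t = int (card {a\<in>A. X a \<le> t})" for t
  define NB where "NB t = int (card {a\<in>B. X a \<le> t})" for t
  have surv: "int (card {v\<in>V - D. X v \<le> t}) = t - int (card {a\<in>D. X a \<le> t})"
    if "D \<subseteq> V" "0 \<le> t" "t \<le> int n" for D t
  proof -
    have "finite D"
      using that fV finite_subset by auto
    have "{v\<in>V. X v \<le> t} = {v\<in>V - D. X v \<le> t} \<union> {a\<in>D. X a \<le> t}"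
      using that by auto
    moreover have "{v\<in>V - D. X v \<le> t} \<inter> {a\<in>D. X a \<le> t} = {}"
      by auto
    ultimately have "card {v\<in>V. X v \<le> t} = card {v\<in>V - D. X v \<le> t} + card {a\<in>D. X a \<le> t}"
      using fV \<open>finite D\<close> by (simp add: card_Un_disjoint)
    then show ?thesis
      using card_bij_le[OF X that(2,3)] by linarith
  qed
  have rank_eq: "X p - NB (X p) = X (\<phi> p) - NA (X (\<phi> p))" if p: "p \<in> V - B" for p
  proof -
    have "bij_betw \<phi> {v\<in>V - B. X v \<le> X p} {v\<in>V - A. X v \<le> X (\<phi> p)}"
      unfolding bij_betw_def
    proof
      show "inj_on \<phi> {v\<in>V - B. X v \<le> X p}"
        using \<phi> by (auto simp: bij_betw_def inj_on_def)
      show "\<phi> ` {v\<in>V - B. X v \<le> X p} = {v\<in>V - A. X v \<le> X (\<phi> p)}"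
      proof
        show "\<phi> ` {v\<in>V - B. X v \<le> X p} \<subseteq> {v\<in>V - A. X v \<le> X (\<phi> p)}"
          using \<phi>V le_iff p by blast
        show "{v\<in>V - A. X v \<le> X (\<phi> p)} \<subseteq> \<phi> ` {v\<in>V - B. X v \<le> X p}"
        proof
          fix v assume v: "v \<in> {v\<in>V - A. X v \<le> X (\<phi> p)}"
          then obtain w where "w \<in> V - B" "v = \<phi> w"
            using \<phi> unfolding bij_betw_def by blast
          then show "v \<in> \<phi> ` {v\<in>V - B. X v \<le> X p}"
            using v le_iff[of w p] p by auto
        qed
      qed
    qed
    then have "card {v\<in>V - B. X v \<le> X p} = card {v\<in>V - A. X v \<le> X (\<phi> p)}"
      by (rule bij_betw_same_card)
    then show ?thesis
      using surv[OF AB(2), of "X p"] surv[OF AB(1), of "X (\<phi> p)"] rng[of p] rng[of "\<phi> p"] p \<phi>V[OF p]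
      unfolding NA_def NB_def by auto
  qed
  have NA_lip: "NA t - NA s \<le> t - s" if "0 \<le> s" "s \<le> t" "t \<le> int n" for s t
  proof -
    have "card {v\<in>V - A. X v \<le> s} \<le> card {v\<in>V - A. X v \<le> t}"
      using that fV by (intro card_mono) auto
    then show ?thesis
      using surv[OF AB(1), of s] surv[OF AB(1), of t] that unfolding NA_def by linarith
  qed
  \<comment> \<open>If \<open>p\<close> did not move right, \<open>rank_eq\<close> and
    \<open>NB (X p) < NA (X p)\<close> would make \<open>NA\<close> grow by more than the length of
    the interval from \<open>X (\<phi> p)\<close> to \<open>X p\<close>, against
    \<open>NA_lip\<close>.\<close>
  have right: "X p < X (\<phi> p)" if "p \<in> V - B" "NB (X p) < NA (X p)" for p
  proof (rule ccontr)
    assume "\<not> X p < X (\<phi> p)"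
    then show False
      using NA_lip[of "X (\<phi> p)" "X p"] rank_eq[OF that(1)] that rng[of p] rng[of "\<phi> p"] \<phi>V[of p]
      by auto
  qed
  \<comment> \<open>Past the last level \<open>t\<close> at which \<open>A\<close> does not outnumber \<open>B\<close>, every point of \<open>A - B\<close> moves right.\<close>
  define T where "T = {t. 0 \<le> t \<and> t \<le> X u \<and> NA t \<le> NB t}"
  have "finite T"
    unfolding T_def by (rule finite_subset[of _ "{0..X u}"]) auto
  have "NA 0 = 0"
  proof -
    have "{a\<in>A. X a \<le> 0} = {}"
      using rng AB by fastforce
    then show ?thesis unfolding NA_def by (simp only: card.empty of_nat_0)
  qed
  then have "0 \<in> T"
    using rng[of u] u by (auto simp: T_def NB_def)
  define t where "t = Max T"
  have "t \<in> T"
    using \<open>finite T\<close> \<open>0 \<in> T\<close> Max_in unfolding t_def by auto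
  then have t: "0 \<le> t" "t \<le> X u" "NA t \<le> NB t"
    by (auto simp: T_def)
  have above: "NB s < NA s" if "t < s" "s \<le> X u" for s
  proof (rule ccontr)
    assume "\<not> NB s < NA s"
    then have "s \<in> T" using that t by (auto simp: T_def)
    then have "s \<le> t" using \<open>finite T\<close> by (simp add: t_def)
    then show False using that by simp
  qed
  let ?P = "{a\<in>A - B. X a < X (\<phi> a) \<and> X a < X (\<phi> u)}"
  let ?C = "{c\<in>A \<inter> B. X u < X c \<and> X c < X (\<phi> u)}"
  let ?B = "{b\<in>B. t < X b \<and> X b \<le> X u}"
  \<comment> \<open>The points of \<open>?B\<close> cancel against the count for \<open>B\<close>. A
    point of \<open>A - B\<close> moves right by \<open>right\<close> if it lies weakly left of
    \<open>u\<close>; otherwise its image lies beyond \<open>\<phi> u\<close> and hence beyond the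
    point itself.\<close>
  have "{a\<in>A. t < X a \<and> X a \<le> X (\<phi> u)} \<subseteq> ?P \<union> ?C \<union> ?B"
  proof
    fix a assume a: "a \<in> {a\<in>A. t < X a \<and> X a \<le> X (\<phi> u)}"
    then have aV: "a \<in> V" using AB by auto
    have lt: "X a < X (\<phi> u)"
      using a inj[OF aV, of "\<phi> u"] \<phi>V[OF u(1)] by fastforce
    show "a \<in> ?P \<union> ?C \<union> ?B"
    proof (cases "a \<in> B")
      case True
      then show ?thesis using a lt by auto
    next
      case False
      have "X a < X (\<phi> a)"
      proof (cases "X a \<le> X u")
        case True
        then show ?thesis using right[of a] above[of "X a"] a aV False by auto
      next
        case F: False
        then have "X (\<phi> u) < X (\<phi> a)" using mono[of u a] u aV False by auto
        then show ?thesis using lt by simp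
      qed
      then show ?thesis using a lt False by auto
    qed
  qed
  then have "card {a\<in>A. t < X a \<and> X a \<le> X (\<phi> u)} \<le> card (?P \<union> ?C \<union> ?B)"
    using fin by (intro card_mono) auto
  also have "\<dots> \<le> card ?P + card ?C + card ?B"
    by (meson card_Un_le add_le_mono order_refl order_trans)
  finally have "card {a\<in>A. t < X a \<and> X a \<le> X (\<phi> u)} \<le> card ?P + card ?C + card ?B" .
  moreover have "NA (X (\<phi> u)) = NA t + int (card {a\<in>A. t < X a \<and> X a \<le> X (\<phi> u)})"
    using card_split_le[OF fin(1), of t "X (\<phi> u)" X] t u unfolding NA_def by simp
  moreover have "NB (X u) = NB t + int (card ?B)"
    using card_split_le[OF fin(2), of t "X u" X] t unfolding NB_def by simp
  ultimately show ?thesis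
    using rank_eq[OF u(1)] t(3) by linarith
qed

section \<open>Separated points in a box and the extremal pair of moves\<close>

lemma card_Un_Int_le:
  assumes "finite D" "P \<subseteq> D" "Q \<subseteq> D"
  shows "card P + card Q \<le> card D + card (P \<inter> Q)"
proof -
  have "card P + card Q = card (P \<union> Q) + card (P \<inter> Q)"
    using assms by (meson card_Un_Int finite_subset)
  then show ?thesis
    using card_mono[of D "P \<union> Q"] assms by simp
qed

lemma sum_abs_diff3_le:
  fixes a b c x w :: int
  assumes "x \<le> a" "a < x + w" "x \<le> b" "b < x + w" "x \<le> c" "c < x + w"
  shows "\<bar>a - b\<bar> + \<bar>b - c\<bar> + \<bar>a - c\<bar> \<le> 2 * (w - 1)"
  using assms by (simp add: abs_if)

text \<open>Two points in the box are at distance at most \<open>w + h - 2\<close>, which is at most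
  \<open>k\<close> if \<open>S\<close> has two elements. For three or four elements, the pairwise
  distances of any three points sum to at most \<open>2 * (w + h - 2)\<close>, hence to at most
  \<open>2 * k + 4\<close>, while separation demands \<open>3 * k + 6\<close>.\<close>

lemma separated_points_in_box:
  fixes X Y :: "'a \<Rightarrow> int" and k w h :: int
  assumes fin: "finite S" and k: "0 \<le> k"
    and sep: "\<And>p q. p \<in> S \<Longrightarrow> q \<in> S \<Longrightarrow> p \<noteq> q \<Longrightarrow> k + 2 \<le> \<bar>X p - X q\<bar> + \<bar>Y p - Y q\<bar>"
    and box: "\<And>p. p \<in> S \<Longrightarrow> x \<le> X p \<and> X p < x + w \<and> y \<le> Y p \<and> Y p < y + h"
    and dims: "w \<le> k" "h \<le> k" "w + h \<le> k + int (card S)"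
  shows "card S \<le> 1"
proof (rule ccontr)
  assume ge2: "\<not> card S \<le> 1"
  \<comment> \<open>Each quadrant of the box contains at most one point.\<close>
  define quad where "quad p = (2 * (X p - x) < w, 2 * (Y p - y) < h)" for p
  have "inj_on quad S"
  proof (rule inj_onI, rule ccontr)
    fix p q assume pq: "p \<in> S" "q \<in> S" "quad p = quad q" "p \<noteq> q"
    have "2 * \<bar>X p - X q\<bar> \<le> w"
      using box[OF pq(1)] box[OF pq(2)] pq(3) unfolding quad_def by (simp add: abs_if) linarith
    moreover have "2 * \<bar>Y p - Y q\<bar> \<le> h"
      using box[OF pq(1)] box[OF pq(2)] pq(3) unfolding quad_def by (simp add: abs_if) linarith
    moreover have False if "2 * a \<le> w" "2 * b \<le> h" "k + 2 \<le> a + b" for a b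
      using that dims k by linarith
    ultimately show False
      using sep[OF pq(1,2,4)] by blast
  qed
  then have "card S \<le> card (UNIV :: (bool \<times> bool) set)"
    by (metis card_image card_mono finite subset_UNIV)
  then have le4: "card S \<le> 4"
    by (simp add: card_UNIV_bool flip: UNIV_Times_UNIV)
  obtain p where p: "p \<in> S" using ge2 by fastforce
  have "card (S - {p}) \<noteq> 0" using ge2 p fin by (auto simp: card_Diff_singleton)
  then obtain q where q: "q \<in> S" "q \<noteq> p" by (metis DiffE card.empty equals0I singletonI)
  show False
  proof (cases "card S = 2")
    case True
    then show False using sep[of p q] box[of p] box[of q] p q dims by auto
  next
    case False
    have "card (S - {p} - {q}) \<noteq> 0" using ge2 p q fin False by (auto simp: card_Diff_singleton)
    then obtain r where r: "r \<in> S" "r \<noteq> p" "r \<noteq> q" by (metis DiffE card.empty equals0I singletonI)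
    have "\<bar>X p - X q\<bar> + \<bar>X q - X r\<bar> + \<bar>X p - X r\<bar> \<le> 2 * (w - 1)"
      using box[OF p] box[OF q(1)] box[OF r(1)] by (intro sum_abs_diff3_le) auto
    moreover have "\<bar>Y p - Y q\<bar> + \<bar>Y q - Y r\<bar> + \<bar>Y p - Y r\<bar> \<le> 2 * (h - 1)"
      using box[OF p] box[OF q(1)] box[OF r(1)] by (intro sum_abs_diff3_le) auto
    ultimately show False
      using sep[of p q] sep[of q r] sep[of p r] p q r dims le4 k by simp
  qed
qed

text \<open>The leftmost choice \<open>L\<close> and the lowest choice \<open>R\<close> both reverse
  order, so \<open>R\<close> after \<open>L\<close> is monotone in the \<open>Y\<close> coordinate
  and has a fixed point as in the Knaster-Tarski theorem.\<close>

lemma mutual_minima: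
  fixes X Y X' Y' :: "'a \<Rightarrow> int"
  assumes fin: "finite N" and ne: "N \<noteq> {}"
    and X': "\<And>a. a \<in> N \<Longrightarrow> X a < X' a" and Y': "\<And>a. a \<in> N \<Longrightarrow> Y a < Y' a"
    and Xm: "\<And>a b. a \<in> N \<Longrightarrow> b \<in> N \<Longrightarrow> X a \<le> X b \<Longrightarrow> X' a \<le> X' b"
    and Ym: "\<And>a b. a \<in> N \<Longrightarrow> b \<in> N \<Longrightarrow> Y a \<le> Y b \<Longrightarrow> Y' a \<le> Y' b"
  obtains u v where "u \<in> N" "v \<in> N" "Y u < Y' v" "X v < X' u"
    "\<And>c. c \<in> N \<Longrightarrow> Y c < Y' v \<Longrightarrow> X u \<le> X c"
    "\<And>c. c \<in> N \<Longrightarrow> X c < X' u \<Longrightarrow> Y v \<le> Y c"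
proof -
  define L where "L v = arg_min_on X {c\<in>N. Y c < Y' v}" for v
  define R where "R u = arg_min_on Y {c\<in>N. X c < X' u}" for u
  have L: "L v \<in> N" "Y (L v) < Y' v" if "v \<in> N" for v
    using arg_min_if_finite(1)[of "{c\<in>N. Y c < Y' v}" X] that fin Y' unfolding L_def by auto
  have L_least: "X (L v) \<le> X c" if "c \<in> N" "Y c < Y' v" for v c
    using arg_min_least[of "{c\<in>N. Y c < Y' v}" c X] that fin unfolding L_def by auto
  have R: "R u \<in> N" "X (R u) < X' u" if "u \<in> N" for u
    using arg_min_if_finite(1)[of "{c\<in>N. X c < X' u}" Y] that fin X' unfolding R_def by auto
  have R_least: "Y (R u) \<le> Y c" if "c \<in> N" "X c < X' u" for u c
    using arg_min_least[of "{c\<in>N. X c < X' u}" c Y] that fin unfolding R_def by auto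
  have L_anti: "X (L b) \<le> X (L a)" if "a \<in> N" "b \<in> N" "Y a \<le> Y b" for a b
    using L_least[of "L a" b] L[of a] Ym[OF that] that by simp
  have R_anti: "Y (R b) \<le> Y (R a)" if "a \<in> N" "b \<in> N" "X a \<le> X b" for a b
    using R_least[of "R a" b] R[of a] Xm[OF that] that by simp
  have T_mono: "Y (R (L a)) \<le> Y (R (L b))" if "a \<in> N" "b \<in> N" "Y a \<le> Y b" for a b
    using R_anti[of "L b" "L a"] L_anti[OF that] L that by simp
  \<comment> \<open>\<open>D\<close> consists of the pre-fixed points. The highest point of
    \<open>N\<close> is one, and \<open>D\<close> is closed under \<open>R\<close> after
    \<open>L\<close>, so its lowest element is fixed.\<close>
  define D where "D = {a\<in>N. Y (R (L a)) \<le> Y a}"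
  have "finite D" using fin by (simp add: D_def)
  obtain m where m: "m \<in> N" "\<And>c. c \<in> N \<Longrightarrow> Y c \<le> Y m"
    using arg_min_if_finite(1)[OF fin ne, of "\<lambda>a. - Y a"]
      arg_min_least[OF fin ne, of _ "\<lambda>a. - Y a"] by auto
  have "m \<in> D" using m(1) m(2)[OF R(1)[OF L(1)[OF m(1)]]] by (simp add: D_def)
  define v where "v = arg_min_on Y D"
  have v: "v \<in> D"
    using arg_min_if_finite(1)[of D Y] \<open>finite D\<close> \<open>m \<in> D\<close> unfolding v_def by auto
  have v_least: "Y v \<le> Y c" if "c \<in> D" for c
    using arg_min_least[of D c Y] that \<open>finite D\<close> unfolding v_def by auto
  have vN: "v \<in> N" using v by (simp add: D_def)
  have "R (L v) \<in> D"
    using T_mono[of "R (L v)" v] v L R by (auto simp: D_def)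
  then have eq: "Y (R (L v)) = Y v"
    using v_least v by (fastforce simp: D_def)
  show ?thesis
  \<comment> \<open>\<open>Y\<close> is not assumed injective, so \<open>v\<close> is fixed only up
    to its \<open>Y\<close> coordinate. Taking \<open>R (L v)\<close> for \<open>v\<close> makes the
    second minimality literal, and equal \<open>Y\<close> gives equal \<open>Y'\<close> for the
    first.\<close>
  proof (rule that[of "L v" "R (L v)"])
    have Y'eq: "Y' (R (L v)) = Y' v"
      using Ym[of v "R (L v)"] Ym[of "R (L v)" v] eq vN L R by (simp add: order_antisym)
    show "Y (L v) < Y' (R (L v))" using L vN Y'eq by simp
    show "X (L v) \<le> X c" if "c \<in> N" "Y c < Y' (R (L v))" for c
      using L_least that Y'eq by simp
  qed (use L R R_least vN in auto)
qed

lemma no_northeast_move: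
  fixes X Y :: "'a \<Rightarrow> int"
  assumes X: "bij_betw X V {1..int n}" and Y: "bij_betw Y V {1..int n}"
    and AB: "A \<subseteq> V" "B \<subseteq> V" and card: "card A = k"
    and \<phi>: "bij_betw \<phi> (V - B) (V - A)"
    and Xm: "\<And>p q. p \<in> V - B \<Longrightarrow> q \<in> V - B \<Longrightarrow> X p < X q \<Longrightarrow> X (\<phi> p) < X (\<phi> q)"
    and Ym: "\<And>p q. p \<in> V - B \<Longrightarrow> q \<in> V - B \<Longrightarrow> Y p < Y q \<Longrightarrow> Y (\<phi> p) < Y (\<phi> q)"
    and sep: "\<And>p q. p \<in> V \<Longrightarrow> q \<in> V \<Longrightarrow> p \<noteq> q \<Longrightarrow> int k + 2 \<le> \<bar>X p - X q\<bar> + \<bar>Y p - Y q\<bar>"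
    and u0: "u0 \<in> V - B" "X u0 < X (\<phi> u0)" "Y u0 < Y (\<phi> u0)"
  shows False
proof -
  have fV: "finite V"
    using X bij_betw_finite by fastforce
  have finA: "finite A"
    using AB fV finite_subset by auto
  have \<phi>V: "\<phi> p \<in> V - A" if "p \<in> V - B" for p
    using \<phi> that by (auto simp: bij_betw_def)
  have Xinj: "X p = X q \<Longrightarrow> p = q" and Yinj: "Y p = Y q \<Longrightarrow> p = q" if "p \<in> V" "q \<in> V" for p q
    using X Y that unfolding bij_betw_def inj_on_def by auto
  define M where "M = {p\<in>V - B. X p < X (\<phi> p) \<and> Y p < Y (\<phi> p)}"
  define N where "N = M \<inter> A"
  have NV: "c \<in> V" "c \<in> V - B" "c \<in> A - B" "X c < X (\<phi> c)" "Y c < Y (\<phi> c)" if "c \<in> N" for c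
    using that by (auto simp: N_def M_def)
  have "finite M" "u0 \<in> M" using fV u0 by (auto simp: M_def)
  define m where "m = arg_min_on X M"
  have mM: "m \<in> M"
    using arg_min_if_finite(1)[of M X] \<open>finite M\<close> \<open>u0 \<in> M\<close> unfolding m_def by auto
  have m_least: "X m \<le> X c" if "c \<in> M" for c
    using arg_min_least[of M c X] that \<open>finite M\<close> unfolding m_def by auto
  \<comment> \<open>Otherwise \<open>m\<close> is the image of a survivor \<open>p\<close>. As
    \<open>m\<close> moves north-east, monotonicity forces \<open>p\<close> to have moved north-east
    to \<open>m\<close>, so \<open>p\<close> would be a north-east mover further left.\<close>
  have "m \<in> A"
  proof (rule ccontr)
    assume "m \<notin> A"
    then have "m \<in> V - A" using mM by (auto simp: M_def)
    then obtain p where p: "p \<in> V - B" "m = \<phi> p"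
      using \<phi> unfolding bij_betw_def by blast
    have mV: "m \<in> V - B" using mM by (auto simp: M_def)
    have *: "X m < X (\<phi> m)" "Y m < Y (\<phi> m)" using mM by (auto simp: M_def)
    have "X p < X m"
      using Xm[of m p] Xinj[of m p] * p mV by (metis DiffD1 linorder_neqE order_less_asym)
    moreover have "Y p < Y m"
      using Ym[of m p] Yinj[of m p] * p mV by (metis DiffD1 linorder_neqE order_less_asym)
    ultimately have "p \<in> M" using p by (auto simp: M_def)
    then show False using m_least[of p] \<open>X p < X m\<close> by simp
  qed
  then have "N \<noteq> {}" using mM by (auto simp: N_def)
  have finN: "finite N" using \<open>finite M\<close> by (simp add: N_def)
  have Xm': "X (\<phi> a) \<le> X (\<phi> b)" if "a \<in> N" "b \<in> N" "X a \<le> X b" for a b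
    using Xm[of a b] Xinj[of a b] NV(1,2) that by (metis order_le_less order_refl)
  have Ym': "Y (\<phi> a) \<le> Y (\<phi> b)" if "a \<in> N" "b \<in> N" "Y a \<le> Y b" for a b
    using Ym[of a b] Yinj[of a b] NV(1,2) that by (metis order_le_less order_refl)
  obtain u v where uv: "u \<in> N" "v \<in> N" "Y u < Y (\<phi> v)" "X v < X (\<phi> u)"
    and u_least: "\<And>c. c \<in> N \<Longrightarrow> Y c < Y (\<phi> v) \<Longrightarrow> X u \<le> X c"
    and v_least: "\<And>c. c \<in> N \<Longrightarrow> X c < X (\<phi> u) \<Longrightarrow> Y v \<le> Y c"
    by (rule mutual_minima[of N X "\<lambda>a. X (\<phi> a)" Y "\<lambda>a. Y (\<phi> a)"])
      (use finN \<open>N \<noteq> {}\<close> NV(4,5) Xm' Ym' in auto)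
  define P where "P = {a\<in>A - B. X a < X (\<phi> a) \<and> X a < X (\<phi> u)}"
  define Q where "Q = {a\<in>A - B. Y a < Y (\<phi> a) \<and> Y a < Y (\<phi> v)}"
  define C where "C = {c\<in>A \<inter> B. X u < X c \<and> X c < X (\<phi> u)}"
  define E where "E = {c\<in>A \<inter> B. Y v < Y c \<and> Y c < Y (\<phi> v)}"
  have w: "X (\<phi> u) - X u \<le> int (card P) + int (card C)"
    unfolding P_def C_def using displacement_le[OF X AB \<phi> Xm NV(2)[OF uv(1)] NV(4)[OF uv(1)]] by simp
  have h: "Y (\<phi> v) - Y v \<le> int (card Q) + int (card E)"
    unfolding Q_def E_def using displacement_le[OF Y AB \<phi> Ym NV(2)[OF uv(2)] NV(5)[OF uv(2)]] by simp
  have cA: "card (A - B) + card (A \<inter> B) = k"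
    using card finA by (metis card_Diff_subset_Int card_mono finite_Int inf_le1 le_add_diff_inverse2)
  have sub: "P \<subseteq> A - B" "Q \<subseteq> A - B" "C \<subseteq> A \<inter> B" "E \<subseteq> A \<inter> B"
    by (auto simp: P_def Q_def C_def E_def)
  have cards: "card P \<le> card (A - B)" "card Q \<le> card (A - B)"
    "card C \<le> card (A \<inter> B)" "card E \<le> card (A \<inter> B)"
    using sub finA by (auto intro!: card_mono)
  \<comment> \<open>Inclusion-exclusion inside \<open>A - B\<close> and inside
    \<open>A \<inter> B\<close> bounds the sum of the two displacements by \<open>k\<close> plus the
    size of this overlap.\<close>
  define S where "S = (P \<inter> Q) \<union> (C \<inter> E)"
  have "card S = card (P \<inter> Q) + card (C \<inter> E)"
    unfolding S_def using sub finA by (intro card_Un_disjoint) (auto intro: finite_subset)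
  moreover have "card P + card Q \<le> card (A - B) + card (P \<inter> Q)"
    using card_Un_Int_le sub finA by (metis finite_Diff)
  moreover have "card C + card E \<le> card (A \<inter> B) + card (C \<inter> E)"
    using card_Un_Int_le sub finA by (metis finite_Int)
  ultimately have sum: "(X (\<phi> u) - X u) + (Y (\<phi> v) - Y v) \<le> int k + int (card S)"
    using w h cA by linarith
  \<comment> \<open>In this form the minimality of \<open>u\<close> and \<open>v\<close> puts
    \<open>P \<inter> Q\<close> inside the box with lower left corner \<open>(X u, Y v)\<close>. For
    \<open>C \<inter> E\<close> this holds by definition.\<close>
  have PQ: "P \<inter> Q = {c\<in>N. X c < X (\<phi> u) \<and> Y c < Y (\<phi> v)}"
    using AB by (auto simp: P_def Q_def N_def M_def)
  have SA: "S \<subseteq> A" using sub by (auto simp: S_def)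
  have "card S \<le> 1"
  proof (rule separated_points_in_box[where X = X and Y = Y and k = "int k" and x = "X u" and y = "Y v"
        and w = "X (\<phi> u) - X u" and h = "Y (\<phi> v) - Y v"])
    show "finite S" using SA finA finite_subset by auto
    show "int k + 2 \<le> \<bar>X p - X q\<bar> + \<bar>Y p - Y q\<bar>" if "p \<in> S" "q \<in> S" "p \<noteq> q" for p q
      using sep that SA AB by blast
    show "X u \<le> X p \<and> X p < X u + (X (\<phi> u) - X u) \<and> Y v \<le> Y p \<and> Y p < Y v + (Y (\<phi> v) - Y v)"
      if "p \<in> S" for p
      using that u_least v_least unfolding S_def PQ by (auto simp: C_def E_def)
    show "X (\<phi> u) - X u \<le> int k" "Y (\<phi> v) - Y v \<le> int k"
      using w h cards cA by linarith+
  qed (use sum in auto)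
  moreover have "u \<in> S" "v \<in> S"
    using uv NV by (auto simp: S_def PQ)
  ultimately have "u = v"
    using SA finA by (metis card_le_Suc0_iff_eq One_nat_def finite_subset)
  \<comment> \<open>With \<open>u = v\<close> the box is spanned by \<open>u\<close> and
    \<open>\<phi> u\<close>, two different points whose distance would then be at most
    \<open>k + 1\<close>.\<close>
  have "u \<in> V" "\<phi> u \<in> V" "u \<noteq> \<phi> u"
    using uv NV \<phi>V by fastforce+
  then have "int k + 2 \<le> \<bar>X u - X (\<phi> u)\<bar> + \<bar>Y u - Y (\<phi> u)\<bar>"
    using sep by blast
  then show False
    using sum \<open>u = v\<close> \<open>card S \<le> 1\<close> NV(4,5)[OF uv(1)] by simp
qed

section \<open>A separated permutation of every admissible length\<close>

lemma rank_less:
  fixes K :: "'a \<Rightarrow> 'b::linorder"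
  assumes "finite S" "w \<in> S" "K v < K w"
  shows "card {x\<in>S. K x \<le> K v} < card {x\<in>S. K x \<le> K w}"
proof (rule psubset_card_mono)
  have "w \<in> {x\<in>S. K x \<le> K w} - {x\<in>S. K x \<le> K v}"
    using assms by auto
  then show "{x\<in>S. K x \<le> K v} \<subset> {x\<in>S. K x \<le> K w}"
    using assms by auto
qed (use assms in simp)

lemma bij_betw_rank:
  fixes K :: "'a \<Rightarrow> 'b::linorder"
  assumes fin: "finite S" and K: "inj_on K S"
  shows "bij_betw (\<lambda>v. card {x\<in>S. K x \<le> K v}) S {1..card S}"
proof -
  let ?r = "\<lambda>v. card {x\<in>S. K x \<le> K v}"
  have inj: "inj_on ?r S"
  proof (rule inj_onI)
    fix v w assume vw: "v \<in> S" "w \<in> S" "?r v = ?r w"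
    then have "K v = K w"
      using rank_less[of S w K v] rank_less[of S v K w] fin
      by (cases "K v" "K w" rule: linorder_cases) auto
    then show "v = w" using K vw by (auto simp: inj_on_def)
  qed
  have "?r v \<in> {1..card S}" if "v \<in> S" for v
  proof -
    have "?r v \<le> card S" using fin by (intro card_mono) auto
    moreover have "?r v \<noteq> 0" using that fin by (auto simp: card_eq_0_iff)
    ultimately show ?thesis by simp
  qed
  then have "?r ` S \<subseteq> {1..card S}" by auto
  moreover have "card (?r ` S) = card {1..card S}" using inj by (simp add: card_image)
  ultimately have "?r ` S = {1..card S}" by (intro card_subset_eq) auto
  then show ?thesis using inj by (simp add: bij_betw_def)
qed

section \<open>Runs of residue classes and their separation\<close>

definition separated :: "nat \<Rightarrow> nat \<Rightarrow> (nat \<Rightarrow> nat) \<Rightarrow> bool" where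
  "separated d n \<sigma> \<longleftrightarrow> (\<forall>p\<in>{1..n}. \<forall>q\<in>{1..n}. p \<noteq> q \<longrightarrow>
     int d \<le> \<bar>int p - int q\<bar> + \<bar>int (\<sigma> p) - int (\<sigma> q)\<bar>)"

text \<open>
  The run with index \<open>s\<close> consists of the \<open>v\<close> with \<open>2 * v + 1\<close> congruent to \<open>s\<close> modulo
  \<open>2 * e + 1\<close>, and \<open>residue_at e s\<close> is its least element. Passing to the next run changes the
  residue by \<open>- e\<close> or \<open>e + 1\<close>.
\<close>

definition residue_at :: "nat \<Rightarrow> nat \<Rightarrow> nat" where
  "residue_at e s = (if even s then e + s div 2 else s div 2)"

lemma residue_at_less: "s \<le> 2 * e \<Longrightarrow> residue_at e s < 2 * e + 1"
  by (auto simp: residue_at_def)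

text \<open>Modulo the odd number \<open>2 * e + 1\<close>, doubling and adding one permutes the
  residues, and \<open>residue_at e\<close> is the inverse. The multiple \<open>j\<close> of the
  modulus is 1 for even \<open>s\<close> and 0 for odd \<open>s\<close>.\<close>

lemma run_of_residue_at:
  assumes "s \<le> 2 * e"
  shows "(2 * (residue_at e s + i * (2 * e + 1)) + 1) mod (2 * e + 1) = s"
proof -
  obtain j where "2 * residue_at e s + 1 = s + j * (2 * e + 1)"
  proof (cases "even s")
    case True
    then show thesis by (intro that[of 1]) (auto simp: residue_at_def)
  next
    case False
    then show thesis by (intro that[of 0]) (auto simp: residue_at_def)
  qed
  then have "2 * (residue_at e s + i * (2 * e + 1)) + 1 = s + (j + 2 * i) * (2 * e + 1)"
    by (simp add: algebra_simps)
  then show ?thesis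
    using assms by (simp only: mod_mult_self1) simp
qed

text \<open>This gives every number coordinates: its run, and its position in the run counted from
  0. For the residue \<open>c\<close>, the value \<open>2 * c + 1\<close> wraps around once if
  \<open>e \<le> c\<close> and not at all otherwise.\<close>

lemma residue_at_run_of:
  "v = residue_at e ((2 * v + 1) mod (2 * e + 1)) + v div (2 * e + 1) * (2 * e + 1)"
proof -
  define c where "c = v mod (2 * e + 1)"
  have c: "c \<le> 2 * e"
    using mod_less_divisor[of "2 * e + 1" v] unfolding c_def by linarith
  have "(2 * v + 1) mod (2 * e + 1) = (2 * c + 1) mod (2 * e + 1)"
    unfolding c_def by (metis mod_add_left_eq mod_mult_right_eq)
  moreover have "residue_at e ((2 * c + 1) mod (2 * e + 1)) = c"
  proof (cases "c < e")
    case True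
    then have "(2 * c + 1) mod (2 * e + 1) = 2 * c + 1"
      by (intro mod_less) simp
    then show ?thesis by (simp add: residue_at_def)
  next
    case False
    then have "2 * c + 1 = 2 * (c - e) + 1 * (2 * e + 1)"
      by simp
    then have "(2 * c + 1) mod (2 * e + 1) = 2 * (c - e) mod (2 * e + 1)"
      by (metis mod_mult_self1)
    also have "\<dots> = 2 * (c - e)"
      using c False by (intro mod_less) linarith
    finally have "(2 * c + 1) mod (2 * e + 1) = 2 * (c - e)" .
    then show ?thesis using False by (simp add: residue_at_def)
  qed
  ultimately show ?thesis
    using mod_div_mult_eq[of v "2 * e + 1"] unfolding c_def by simp
qed

text \<open>Sorts \<open>{..<n}\<close> by run, decreasingly inside each run.\<close>

definition zigzag_key :: "nat \<Rightarrow> nat \<Rightarrow> nat \<Rightarrow> int" where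
  "zigzag_key n e v = int ((2 * v + 1) mod (2 * e + 1)) * int n - int v"

text \<open>Subtracting values below \<open>n\<close> cannot outweigh a step of \<open>n\<close>
  caused by a change of run, so the key encodes a lexicographic order.\<close>

lemma zigzag_key_less_iff:
  assumes "v < n" "w < n"
  shows "zigzag_key n e v < zigzag_key n e w \<longleftrightarrow>
    (2 * v + 1) mod (2 * e + 1) < (2 * w + 1) mod (2 * e + 1) \<or>
    (2 * v + 1) mod (2 * e + 1) = (2 * w + 1) mod (2 * e + 1) \<and> w < v"
proof -
  have *: "int s * int n - int x < int t * int n - int y"
    if "s < t" "y < n" for s t x y :: nat
  proof -
    have "(int s + 1) * int n \<le> int t * int n"
      using that by (intro mult_right_mono) auto
    then show ?thesis using that by (simp add: algebra_simps)
  qed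
  consider "(2 * v + 1) mod (2 * e + 1) < (2 * w + 1) mod (2 * e + 1)"
    | "(2 * w + 1) mod (2 * e + 1) < (2 * v + 1) mod (2 * e + 1)"
    | "(2 * v + 1) mod (2 * e + 1) = (2 * w + 1) mod (2 * e + 1)"
    by linarith
  then show ?thesis
  proof cases
    case 1
    then show ?thesis using *[OF 1 assms(2), of v] unfolding zigzag_key_def by auto
  next
    case 2
    then show ?thesis using *[OF 2 assms(1), of w] unfolding zigzag_key_def by auto
  next
    case 3
    then show ?thesis unfolding zigzag_key_def by auto
  qed
qed

text \<open>A lower bound for the length of a run that is sharp for the smallest admissible \<open>n\<close>.\<close>

definition run_bound :: "nat \<Rightarrow> nat \<Rightarrow> nat \<Rightarrow> nat" where
  "run_bound d e s = (if even s then d - e - 1 else d - e)"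

text \<open>\<open>{..<n}\<close> contains \<open>d - e - 1\<close> full periods and at least
  \<open>e\<close> further numbers. The latter provide one more element for the residues below
  \<open>e\<close>, which belong to the runs of odd index.\<close>

lemma run_bound_fits:
  assumes "s \<le> 2 * e" "j < run_bound d e s" and n: "(2 * e + 1) * (d - e - 1) + e \<le> n"
  shows "residue_at e s + j * (2 * e + 1) < n"
proof (cases "even s")
  case True
  then have "j + 1 \<le> d - e - 1" using assms(2) by (simp add: run_bound_def)
  then have "(j + 1) * (2 * e + 1) \<le> (d - e - 1) * (2 * e + 1)"
    by (rule mult_le_mono1)
  then show ?thesis
    using n residue_at_less[OF assms(1)] by (simp add: algebra_simps)
next
  case False
  then have "j \<le> d - e - 1" using assms(2) by (simp add: run_bound_def)
  then have "j * (2 * e + 1) \<le> (d - e - 1) * (2 * e + 1)"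
    by (rule mult_le_mono1)
  moreover have "residue_at e s < e"
    using False assms(1) by (auto simp: residue_at_def elim!: oddE)
  ultimately show ?thesis
    using n by (simp add: algebra_simps)
qed

text \<open>Runs are listed downwards: after position \<open>i\<close> of run \<open>s\<close> come
  the \<open>i\<close> lower positions (\<open>D1\<close>), then the runs in between
  (\<open>D3\<close>), then run \<open>t\<close> from its top down to position \<open>j\<close>
  (\<open>D2\<close>). \<open>M\<close> selects as many intermediate runs as an application
  needs.\<close>

lemma card_between_ge:
  fixes e d n :: nat
  defines "val \<equiv> \<lambda>(s, i). residue_at e s + i * (2 * e + 1)"
  assumes n: "(2 * e + 1) * (d - e - 1) + e \<le> n"
    and s: "s < t" "t \<le> 2 * e" and M: "M \<subseteq> {s<..<t}"
    and vw: "val (s, i) < n" "val (t, j) < n"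
  shows "i + (run_bound d e t - j) + (\<Sum>m\<in>M. run_bound d e m) \<le>
    card {x\<in>{..<n}. zigzag_key n e (val (s, i)) < zigzag_key n e x \<and>
                    zigzag_key n e x \<le> zigzag_key n e (val (t, j))}"
proof -
  have run: "(2 * val (r, a) + 1) mod (2 * e + 1) = r" if "r \<le> 2 * e" for r a
    using run_of_residue_at[OF that] by (simp add: val_def)
  have mono: "val (r, a) < val (r, b) \<longleftrightarrow> a < b" for r a b
    by (simp only: val_def prod.case add_less_cancel_left mult_less_cancel2) simp
  define D1 where "D1 = {s} \<times> {..<i}"
  define D2 where "D2 = {t} \<times> {j..<run_bound d e t}"
  define D3 where "D3 = (SIGMA m:M. {..<run_bound d e m})"
  let ?D = "D1 \<union> D2 \<union> D3"
  have finM: "finite M" using M finite_subset by blast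
  have "D1 \<inter> D2 = {}" "(D1 \<union> D2) \<inter> D3 = {}"
    using s M by (auto simp: D1_def D2_def D3_def)
  then have "card ?D = card D1 + card D2 + card D3"
    using finM by (simp add: card_Un_disjoint D1_def D2_def D3_def)
  then have "card ?D = i + (run_bound d e t - j) + (\<Sum>m\<in>M. run_bound d e m)"
    using finM by (simp add: D1_def D2_def D3_def)
  moreover have "inj_on val ?D"
  proof (rule inj_onI)
    fix p q assume pq: "p \<in> ?D" "q \<in> ?D" "val p = val q"
    obtain r a r' a' where eq: "p = (r, a)" "q = (r', a')"
      by (metis surj_pair)
    then have "r \<le> 2 * e" "r' \<le> 2 * e"
      using pq s M by (auto simp: D1_def D2_def D3_def)
    then have "r = r'"
      using run[of r a] run[of r' a'] pq(3) eq by simp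
    then show "p = q"
      using pq(3) eq mono[of r a a'] mono[of r a' a] by simp
  qed
  moreover have "val ` ?D \<subseteq> {x\<in>{..<n}. zigzag_key n e (val (s, i)) < zigzag_key n e x \<and>
                    zigzag_key n e x \<le> zigzag_key n e (val (t, j))}" (is "_ \<subseteq> ?K")
  proof
    fix x assume "x \<in> val ` ?D"
    then obtain r a where x: "x = val (r, a)" and ra: "(r, a) \<in> ?D"
      by (metis imageE surj_pair)
    have r: "r \<le> 2 * e"
      using ra s M by (auto simp: D1_def D2_def D3_def)
    have xn: "x < n"
    proof (cases "(r, a) \<in> D1")
      case True
      then show ?thesis using vw(1) mono[of r a i] x by (auto simp: D1_def)
    next
      case False
      then have "a < run_bound d e r" using ra by (auto simp: D2_def D3_def)
      then show ?thesis using run_bound_fits[OF r _ n] x by (simp add: val_def)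
    qed
    have s2e: "s \<le> 2 * e" using s by simp
    have "zigzag_key n e (val (s, i)) < zigzag_key n e x \<longleftrightarrow> s < r \<or> s = r \<and> x < val (s, i)"
      unfolding zigzag_key_less_iff[OF vw(1) xn] unfolding x run[OF s2e] run[OF r] ..
    then have "zigzag_key n e (val (s, i)) < zigzag_key n e x"
      using ra M s mono[of r a i] x by (auto simp: D1_def D2_def D3_def)
    moreover have "zigzag_key n e (val (t, j)) < zigzag_key n e x \<longleftrightarrow> t < r \<or> t = r \<and> x < val (t, j)"
      unfolding zigzag_key_less_iff[OF vw(2) xn] unfolding x run[OF s(2)] run[OF r] ..
    then have "\<not> zigzag_key n e (val (t, j)) < zigzag_key n e x"
      using ra M s mono[of r a j] x by (auto simp: D1_def D2_def D3_def)
    ultimately show "x \<in> ?K" using xn by auto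
  qed
  ultimately show ?thesis
    using card_mono[of ?K "val ` ?D"] by (simp add: card_image)
qed

text \<open>The set counted is the difference of ranks. If the position changes by \<open>x\<close>,
  the count loses at most \<open>x\<close>, while the values differ by
  \<open>x * (2 * e + 1)\<close> plus the difference of the residues; the cases follow how many runs
  apart \<open>v\<close> and \<open>w\<close> are.\<close>

lemma zigzag_separated:
  fixes d e n v w :: nat
  assumes d: "2 * e \<le> d" "d \<le> 2 * e + 1" and e: "1 \<le> e" "e + 2 \<le> d"
    and n: "(2 * e + 1) * (d - e - 1) + e \<le> n" and vw: "v < n" "w < n"
    and less: "zigzag_key n e v < zigzag_key n e w"
  shows "int d \<le> int (card {x\<in>{..<n}. zigzag_key n e v < zigzag_key n e x \<and>
                                 zigzag_key n e x \<le> zigzag_key n e w}) + \<bar>int v - int w\<bar>"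
    (is "_ \<le> int (card ?K) + _")
proof -
  define s t i j where "s = (2 * v + 1) mod (2 * e + 1)" and "t = (2 * w + 1) mod (2 * e + 1)"
    and "i = v div (2 * e + 1)" and "j = w div (2 * e + 1)"
  have v: "v = residue_at e s + i * (2 * e + 1)" and w: "w = residue_at e t + j * (2 * e + 1)"
    using residue_at_run_of[of v e] residue_at_run_of[of w e]
    by (simp_all add: s_def t_def i_def j_def)
  have t: "t \<le> 2 * e"
    using mod_less_divisor[of "2 * e + 1" "2 * w + 1"] unfolding t_def by linarith
  have order: "s < t \<or> s = t \<and> w < v"
    using less zigzag_key_less_iff[OF vw] unfolding s_def t_def by blast
  have diff: "int w - int v = int (residue_at e t) - int (residue_at e s) +
      (int j - int i) * (2 * int e + 1)"
    unfolding v w by (simp add: algebra_simps)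
  have count: "int i + int (run_bound d e t) - int j + int (\<Sum>m\<in>M. run_bound d e m) \<le> int (card ?K)"
    if "s < t" "M \<subseteq> {s<..<t}" for M
  proof -
    have "i + (run_bound d e t - j) + (\<Sum>m\<in>M. run_bound d e m) \<le> card ?K"
      using card_between_ge[OF n that(1) t that(2), of i j] vw unfolding v w by simp
    then show ?thesis by linarith
  qed
  define x where "x = int j - int i"
  define E where "E = int e"
  have E: "1 \<le> E" using e by (simp add: E_def)
  \<comment> \<open>Since \<open>2 * e \<le> d\<close>, two consecutive runs together contribute at
    least \<open>d - 1\<close>.\<close>
  have two: "int (run_bound d e m) + int (run_bound d e (Suc m)) = 2 * int d - 2 * E - 1" for m
    using e by (auto simp: run_bound_def E_def)
  \<comment> \<open>Naming the only nonlinear term and bounding it by the sign of \<open>x\<close>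
    leaves linear arithmetic in each case.\<close>
  define z where "z = x * (2 * E)"
  have prod_pos: "z \<ge> 2 * E" if "x \<ge> 1"
    using mult_right_mono[OF that, of "2 * E"] E by (simp add: z_def)
  have prod_pos0: "z \<ge> 0" if "x \<ge> 0"
    using that E by (simp add: z_def)
  have prod_neg: "z \<le> - (2 * E)" if "x \<le> -1"
    using mult_right_mono[OF that, of "2 * E"] E by (simp add: z_def)
  have prod_neg0: "z \<le> 0" if "x \<le> 0"
    using mult_right_mono[OF that, of "2 * E"] E by (simp add: z_def)
  have diff': "int w - int v = int (residue_at e t) - int (residue_at e s) + z + x"
    using diff unfolding z_def x_def E_def by (simp add: algebra_simps)
  consider "s = t" | "t = s + 1" | "t = s + 2" | "s + 3 \<le> t"
    using order by linarith
  then show ?thesis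
  proof cases
    case 1
    then have "w < v" using order by simp
    then have "j < i"
      using v w unfolding 1 by (metis add_less_cancel_left mult_less_cancel2)
    then have "x < 0" unfolding x_def by simp
    then have "int w - int v \<le> - (2 * E + 1)"
      using diff' 1 prod_neg \<open>x < 0\<close> by auto
    moreover have "w \<in> ?K" using vw less by simp
    then have "card ?K \<noteq> 0" by (auto simp: card_eq_0_iff)
    ultimately show ?thesis using d unfolding E_def by linarith
  next
    case 2
    show ?thesis
    proof (cases "even s")
      case True
      then have "int w - int v = z + x - E"
        using diff' 2 unfolding E_def by (auto simp: residue_at_def)
      moreover have "int d - E - x \<le> int (card ?K)"
        using count[of "{}"] 2 True e unfolding x_def E_def by (simp add: run_bound_def)
      ultimately have "int d \<le> int (card ?K) + \<bar>int w - int v\<bar>"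
        using prod_pos prod_neg0 by (cases "x \<ge> 1") auto
      then show ?thesis by (simp add: abs_minus_commute)
    next
      case False
      then have "int w - int v = z + x + E + 1"
        using diff' 2 unfolding E_def by (auto simp: residue_at_def elim!: oddE)
      moreover have "int d - E - 1 - x \<le> int (card ?K)"
        using count[of "{}"] 2 False e unfolding x_def E_def by (simp add: run_bound_def)
      ultimately have "int d \<le> int (card ?K) + \<bar>int w - int v\<bar>"
        using prod_pos0 prod_neg by (cases "x \<ge> 0") auto
      then show ?thesis by (simp add: abs_minus_commute)
    qed
  next
    case 3
    then have "int (residue_at e t) - int (residue_at e s) = 1"
      by (auto simp: residue_at_def)
    then have "int w - int v = z + x + 1"
      using diff' by simp
    moreover have "int d - 1 - x \<le> int (card ?K)"
      using count[of "{s + 1}"] 3 two[of "s + 1"] d unfolding x_def E_def by simp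
    ultimately have "int d \<le> int (card ?K) + \<bar>int w - int v\<bar>"
      using prod_pos0 prod_neg by (cases "x \<ge> 0") auto
    then show ?thesis by (simp add: abs_minus_commute)
  next
    case 4
    have "int (residue_at e t) - int (residue_at e s) \<ge> - 2 * E"
      using residue_at_less[of s e] residue_at_less[OF t] t 4 unfolding E_def by simp
    then have "int w - int v \<ge> z + x - 2 * E"
      using diff' by simp
    moreover have "1 \<le> run_bound d e t" using e by (auto simp: run_bound_def)
    then have "int d - x \<le> int (card ?K)"
      using count[of "{s + 1, s + 2}"] 4 two[of "s + 1"] d unfolding x_def E_def by simp
    ultimately have "int d \<le> int (card ?K) + \<bar>int w - int v\<bar>"
      using prod_pos by (cases "x \<ge> 1") auto
    then show ?thesis by (simp add: abs_minus_commute)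
  qed
qed

lemma exists_separated_permutation:
  fixes d e n :: nat
  assumes d: "2 * e \<le> d" "d \<le> 2 * e + 1" and e: "1 \<le> e" "e + 2 \<le> d"
    and n: "(2 * e + 1) * (d - e - 1) + e \<le> n"
  shows "\<exists>\<sigma>. \<sigma> permutes {1..n} \<and> separated d n \<sigma>"
proof -
  let ?K = "zigzag_key n e"
  define r where "r v = card {x\<in>{..<n}. ?K x \<le> ?K v}" for v
  have inj: "inj_on ?K {..<n}"
  proof (rule inj_onI)
    fix v w assume vw: "v \<in> {..<n}" "w \<in> {..<n}" "?K v = ?K w"
    then show "v = w"
      using zigzag_key_less_iff[of v n w e] zigzag_key_less_iff[of w n v e]
      by (metis lessThan_iff less_irrefl linorder_neqE_nat)
  qed
  have r: "bij_betw r {..<n} {1..n}"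
    using bij_betw_rank[OF finite_lessThan inj] by (simp add: r_def[abs_def])
  have sep_less: "int d \<le> \<bar>int v - int w\<bar> + \<bar>int (r v) - int (r w)\<bar>"
    if "v < n" "w < n" "?K v < ?K w" for v w
  proof -
    have "{x\<in>{..<n}. ?K x \<le> ?K w} =
        {x\<in>{..<n}. ?K x \<le> ?K v} \<union> {x\<in>{..<n}. ?K v < ?K x \<and> ?K x \<le> ?K w}"
      using that by auto
    then have "r w = r v + card {x\<in>{..<n}. ?K v < ?K x \<and> ?K x \<le> ?K w}"
      unfolding r_def by (simp add: card_Un_disjoint disjoint_iff)
    then show ?thesis
      using zigzag_separated[OF d e n that] by simp
  qed
  have sep: "int d \<le> \<bar>int v - int w\<bar> + \<bar>int (r v) - int (r w)\<bar>" if "v < n" "w < n" "v \<noteq> w" for v w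
  proof -
    have "?K v \<noteq> ?K w" using inj that by (auto simp: inj_on_def)
    then consider "?K v < ?K w" | "?K w < ?K v" by linarith
    then show ?thesis
      using sep_less[of v w] sep_less[of w v] that by cases (auto simp: abs_minus_commute)
  qed
  \<comment> \<open>\<open>\<sigma>\<close> maps each value, shifted by one, to its place in the
    listing, so it is the inverse of the listed permutation. Taxicab distance is symmetric in the
    two coordinates.\<close>
  define \<sigma> where "\<sigma> p = (if p \<in> {1..n} then r (p - 1) else p)" for p
  have "bij_betw (\<lambda>p. p - 1) {1..n} {..<n}"
    by (rule bij_betwI[where g = Suc]) auto
  then have "bij_betw (r \<circ> (\<lambda>p. p - 1)) {1..n} {1..n}"
    using r by (rule bij_betw_trans)
  then have "bij_betw \<sigma> {1..n} {1..n}"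
    by (rule bij_betw_cong[THEN iffD1, rotated]) (auto simp: \<sigma>_def)
  then have "\<sigma> permutes {1..n}"
    by (rule bij_imp_permutes) (auto simp: \<sigma>_def)
  moreover have "separated d n \<sigma>"
    unfolding separated_def
  proof (intro ballI impI)
    fix p q assume pq: "p \<in> {1..n}" "q \<in> {1..n}" "p \<noteq> q"
    then have "int d \<le> \<bar>int (p - 1) - int (q - 1)\<bar> + \<bar>int (r (p - 1)) - int (r (q - 1))\<bar>"
      by (intro sep) auto
    then show "int d \<le> \<bar>int p - int q\<bar> + \<bar>int (\<sigma> p) - int (\<sigma> q)\<bar>"
      using pq by (auto simp: \<sigma>_def of_nat_diff)
  qed
  ultimately show ?thesis by blast
qed

section \<open>Separated permutations are prolific\<close>

text \<open>Restates \<open>no_northeast_move\<close> for two embeddings: the deleted sets are the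
  complements of their images, and the isomorphism is \<open>f\<close> after the inverse of
  \<open>g\<close>.\<close>

lemma no_northeast_shift:
  fixes X Y :: "'a \<Rightarrow> int" and f g :: "'b \<Rightarrow> 'a"
  assumes X: "bij_betw X V {1..int n}" and Y: "bij_betw Y V {1..int n}"
    and fg: "inj_on f I" "inj_on g I" "f ` I \<subseteq> V" "g ` I \<subseteq> V" and n: "n = card I + k"
    and Xm: "\<And>i j. i \<in> I \<Longrightarrow> j \<in> I \<Longrightarrow> X (f i) < X (f j) \<longleftrightarrow> X (g i) < X (g j)"
    and Ym: "\<And>i j. i \<in> I \<Longrightarrow> j \<in> I \<Longrightarrow> Y (f i) < Y (f j) \<longleftrightarrow> Y (g i) < Y (g j)"
    and sep: "\<And>p q. p \<in> V \<Longrightarrow> q \<in> V \<Longrightarrow> p \<noteq> q \<Longrightarrow> int k + 2 \<le> \<bar>X p - X q\<bar> + \<bar>Y p - Y q\<bar>"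
    and i: "i \<in> I" "X (g i) < X (f i)" "Y (g i) < Y (f i)"
  shows False
proof -
  define \<phi> where "\<phi> = f \<circ> the_inv_into I g"
  have \<phi>g: "\<phi> (g j) = f j" if "j \<in> I" for j
    using the_inv_into_f_f[OF fg(2) that] by (simp add: \<phi>_def)
  have VB: "V - (V - g ` I) = g ` I" and VA: "V - (V - f ` I) = f ` I"
    using fg by auto
  have "card V = n"
    using bij_betw_same_card[OF X] by simp
  moreover have "finite V"
    using X bij_betw_finite by fastforce
  ultimately have card: "card (V - f ` I) = k"
    using fg n by (simp add: card_Diff_subset card_image finite_subset)
  have "bij_betw \<phi> (g ` I) (f ` I)"
    unfolding \<phi>_def
    using bij_betw_trans[OF bij_betw_the_inv_into[OF inj_on_imp_bij_betw[OF fg(2)]]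
        inj_on_imp_bij_betw[OF fg(1)]] .
  then have \<phi>: "bij_betw \<phi> (V - (V - g ` I)) (V - (V - f ` I))"
    unfolding VA VB .
  show False
  proof (rule no_northeast_move[OF X Y Diff_subset Diff_subset card \<phi> _ _ sep])
    show "g i \<in> V - (V - g ` I)" using i VB by simp
    show "X (\<phi> p) < X (\<phi> q)"
      if "p \<in> V - (V - g ` I)" "q \<in> V - (V - g ` I)" "X p < X q" for p q
      using that Xm \<phi>g unfolding VB by auto
    show "Y (\<phi> p) < Y (\<phi> q)"
      if "p \<in> V - (V - g ` I)" "q \<in> V - (V - g ` I)" "Y p < Y q" for p q
      using that Ym \<phi>g unfolding VB by auto
  qed (use i \<phi>g in auto)
qed

text \<open>If \<open>f i\<close> and \<open>g i\<close> differ, the point moves strictly in both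
  coordinates, in one of four diagonal directions. Exchanging \<open>f\<close> and \<open>g\<close>
  and reflecting the values (\<open>Y'\<close>) reduce all four to a north-east move.\<close>

lemma separated_occurrence_unique:
  assumes \<sigma>: "\<sigma> permutes {1..n}" and sep: "separated (k + 2) n \<sigma>" and n: "n = r + k"
    and f: "strict_mono_on {1..r} f" "f ` {1..r} \<subseteq> {1..n}"
    and g: "strict_mono_on {1..r} g" "g ` {1..r} \<subseteq> {1..n}"
    and iso: "\<And>i j. i \<in> {1..r} \<Longrightarrow> j \<in> {1..r} \<Longrightarrow> \<sigma> (f i) < \<sigma> (f j) \<longleftrightarrow> \<sigma> (g i) < \<sigma> (g j)"
  shows "f ` {1..r} = g ` {1..r}"
proof -
  define Y where "Y p = int (\<sigma> p)" for p
  define Y' where "Y' p = int n + 1 - int (\<sigma> p)" for p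
  have X: "bij_betw int {1..n} {1..int n}"
    by (rule bij_betwI[where g = nat]) auto
  have Y: "bij_betw Y {1..n} {1..int n}"
    using bij_betw_trans[OF permutes_imp_bij[OF \<sigma>] X] by (simp add: Y_def[abs_def] comp_def)
  have "bij_betw (\<lambda>y. int n + 1 - y) {1..int n} {1..int n}"
    by (rule bij_betwI[where g = "\<lambda>y. int n + 1 - y"]) auto
  from bij_betw_trans[OF Y this] have Y': "bij_betw Y' {1..n} {1..int n}"
    by (simp add: Y_def Y'_def[abs_def] comp_def)
  have sepY: "int k + 2 \<le> \<bar>int p - int q\<bar> + \<bar>Y p - Y q\<bar>"
    and sepY': "int k + 2 \<le> \<bar>int p - int q\<bar> + \<bar>Y' p - Y' q\<bar>"
    if "p \<in> {1..n}" "q \<in> {1..n}" "p \<noteq> q" for p q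
  proof -
    have *: "int (k + 2) \<le> \<bar>int p - int q\<bar> + \<bar>int (\<sigma> p) - int (\<sigma> q)\<bar>"
      using sep that unfolding separated_def by blast
    then show "int k + 2 \<le> \<bar>int p - int q\<bar> + \<bar>Y p - Y q\<bar>"
      by (simp add: Y_def)
    show "int k + 2 \<le> \<bar>int p - int q\<bar> + \<bar>Y' p - Y' q\<bar>"
      using * by (simp add: Y'_def abs_minus_commute)
  qed
  have inj: "inj_on f {1..r}" "inj_on g {1..r}"
    using f g strict_mono_on_imp_inj_on by blast+
  have nr: "n = card {1..r} + k" using n by simp
  have Xm: "int (f i) < int (f j) \<longleftrightarrow> int (g i) < int (g j)" if "i \<in> {1..r}" "j \<in> {1..r}" for i j
    using strict_mono_on_less[OF f(1) that] strict_mono_on_less[OF g(1) that] by simp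
  have Ym: "Y (f i) < Y (f j) \<longleftrightarrow> Y (g i) < Y (g j)"
    and Ym': "Y' (f i) < Y' (f j) \<longleftrightarrow> Y' (g i) < Y' (g j)" if "i \<in> {1..r}" "j \<in> {1..r}" for i j
    using iso that by (auto simp: Y_def Y'_def)
  have "f i = g i" if i: "i \<in> {1..r}" for i
  proof (rule ccontr)
    assume ne: "f i \<noteq> g i"
    then have "Y (f i) \<noteq> Y (g i)"
      using permutes_inj[OF \<sigma>] by (auto simp: Y_def inj_def)
    then consider "f i < g i" "Y (f i) < Y (g i)" | "f i < g i" "Y' (f i) < Y' (g i)"
      | "g i < f i" "Y (g i) < Y (f i)" | "g i < f i" "Y' (g i) < Y' (f i)"
      using ne by (auto simp: Y_def Y'_def neq_iff)
    then show False
    proof cases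
      case 1
      then show False
        using no_northeast_shift[OF X Y inj(2,1) g(2) f(2) nr Xm[symmetric] Ym[symmetric] sepY i] by simp
    next
      case 2
      then show False
        using no_northeast_shift[OF X Y' inj(2,1) g(2) f(2) nr Xm[symmetric] Ym'[symmetric] sepY' i] by simp
    next
      case 3
      then show False
        using no_northeast_shift[OF X Y inj f(2) g(2) nr Xm Ym sepY i] by simp
    next
      case 4
      then show False
        using no_northeast_shift[OF X Y' inj f(2) g(2) nr Xm Ym' sepY' i] by simp
    qed
  qed
  then show ?thesis by simp
qed

section \<open>Patterns and their index sets\<close>

lemma strict_mono_on_same_image:
  fixes f g :: "nat \<Rightarrow> nat"
  assumes "strict_mono_on {1..r} f" "strict_mono_on {1..r} g" "f ` {1..r} = g ` {1..r}" "i \<in> {1..r}"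
  shows "f i = g i"
proof -
  have sorted: "sorted (map h [1..<Suc r])" "distinct (map h [1..<Suc r])"
    if "strict_mono_on {1..r} h" for h :: "nat \<Rightarrow> nat"
  proof -
    show "sorted (map h [1..<Suc r])"
      unfolding sorted_map using strict_mono_on_leD[OF that]
      by (intro sorted_wrt_mono_rel[OF _ sorted_upt]) auto
    show "distinct (map h [1..<Suc r])"
      using strict_mono_on_imp_inj_on[OF that] by (simp add: distinct_map atLeastLessThanSuc_atLeastAtMost del: upt_Suc)
  qed
  have "set (map f [1..<Suc r]) = set (map g [1..<Suc r])"
    using assms(3) by (simp add: atLeastLessThanSuc_atLeastAtMost del: upt_Suc)
  then have "map f [1..<Suc r] = map g [1..<Suc r]"
    using sorted_distinct_set_unique sorted assms(1,2) by blast
  then show ?thesis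
    using assms(4) by (simp add: atLeastLessThanSuc_atLeastAtMost del: upt_Suc)
qed

text \<open>Each value of a permutation is its own rank among the values, which comparisons alone
  determine.\<close>

lemma permutes_eq_if_order_isomorphic:
  fixes \<pi> \<rho> :: "nat \<Rightarrow> nat"
  assumes \<pi>: "\<pi> permutes {1..r}" and \<rho>: "\<rho> permutes {1..r}"
    and iso: "\<And>i j. i \<in> {1..r} \<Longrightarrow> j \<in> {1..r} \<Longrightarrow> \<pi> i < \<pi> j \<longleftrightarrow> \<rho> i < \<rho> j"
  shows "\<pi> = \<rho>"
proof
  fix i
  have rank: "card {j\<in>{1..r}. \<tau> j \<le> \<tau> i} = \<tau> i" if \<tau>: "\<tau> permutes {1..r}" and "i \<in> {1..r}" for \<tau>
  proof -
    have "bij_betw int {1..r} {1..int r}"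
      by (rule bij_betwI[where g = nat]) auto
    then have "bij_betw (int \<circ> \<tau>) {1..r} {1..int r}"
      using bij_betw_trans permutes_imp_bij[OF \<tau>] by blast
    moreover have "\<tau> i \<le> r" using permutes_in_image[OF \<tau>, of i] that by auto
    ultimately show ?thesis
      using card_bij_le[of "int \<circ> \<tau>" "{1..r}" r "int (\<tau> i)"] by simp
  qed
  show "\<pi> i = \<rho> i"
  proof (cases "i \<in> {1..r}")
    case True
    then have "{j\<in>{1..r}. \<pi> j \<le> \<pi> i} = {j\<in>{1..r}. \<rho> j \<le> \<rho> i}"
      using iso by (auto simp flip: not_less)
    then show ?thesis using rank \<pi> \<rho> True by metis
  next
    case False
    then show ?thesis using \<pi> \<rho> permutes_not_in by metis
  qed
qed

text \<open>\<open>f\<close> lists \<open>S\<close> in increasing order, and \<open>\<pi>\<close> is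
  the standardisation of \<open>\<sigma>\<close> along it, replacing values by ranks.\<close>

lemma exists_pattern_at:
  fixes \<sigma> :: "nat \<Rightarrow> nat"
  assumes \<sigma>: "\<sigma> permutes {1..n}" and S: "S \<subseteq> {1..n}" "card S = r"
  obtains f \<pi> where "strict_mono_on {1..r} f" "f ` {1..r} = S" "\<pi> permutes {1..r}"
    "\<And>i j. i \<in> {1..r} \<Longrightarrow> j \<in> {1..r} \<Longrightarrow> \<sigma> (f i) < \<sigma> (f j) \<longleftrightarrow> \<pi> i < \<pi> j"
proof -
  have finS: "finite S" using finite_subset[OF S(1)] by simp
  define f where "f i = sorted_list_of_set S ! (i - 1)" for i
  have f: "strict_mono_on {1..r} f"
  proof (rule strict_mono_onI)
    fix i j assume "i \<in> {1..r}" "j \<in> {1..r}" "i < j"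
    then show "f i < f j"
      unfolding f_def using S(2)
      by (intro sorted_wrt_nth_less[OF strict_sorted_list_of_set]) auto
  qed
  have img: "f ` {1..r} = S"
  proof -
    have "f ` Suc ` {0..<r} = nth (sorted_list_of_set S) ` {0..<r}"
      unfolding image_image by (simp add: f_def)
    also have "\<dots> = set (take r (sorted_list_of_set S))"
      using S(2) by (intro nth_image) simp
    also have "\<dots> = S"
      using S(2) finS by simp
    finally show ?thesis
      by (simp add: atLeastLessThanSuc_atLeastAtMost)
  qed
  define K where "K i = \<sigma> (f i)" for i
  have K: "inj_on K {1..r}"
    using comp_inj_on[OF strict_mono_on_imp_inj_on[OF f] permutes_inj_on[OF \<sigma>]]
    by (simp add: K_def[abs_def] comp_def)
  define \<pi> where "\<pi> i = (if i \<in> {1..r} then card {j\<in>{1..r}. K j \<le> K i} else i)" for i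
  have "bij_betw (\<lambda>i. card {j\<in>{1..r}. K j \<le> K i}) {1..r} {1..r}"
    using bij_betw_rank[OF _ K] by simp
  then have "bij_betw \<pi> {1..r} {1..r}"
    by (rule bij_betw_cong[THEN iffD1, rotated]) (auto simp: \<pi>_def)
  then have \<pi>: "\<pi> permutes {1..r}"
    by (rule bij_imp_permutes) (auto simp: \<pi>_def)
  have less: "\<pi> i < \<pi> j" if "i \<in> {1..r}" "j \<in> {1..r}" "K i < K j" for i j
    using rank_less[of "{1..r}" j K i] that by (simp add: \<pi>_def)
  have "K i < K j \<longleftrightarrow> \<pi> i < \<pi> j" if ij: "i \<in> {1..r}" "j \<in> {1..r}" for i j
    using less[OF ij] less[OF ij(2,1)] inj_onD[OF K _ ij]
    by (cases "K i" "K j" rule: linorder_cases) auto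
  then show thesis
    using that f img \<pi> by (simp add: K_def)
qed

text \<open>Sending a pattern to the index set of a chosen occurrence is a bijection onto the
  \<open>r\<close>-subsets. Injectivity holds for every permutation; separation enters through
  surjectivity.\<close>

lemma separated_imp_prolific:
  assumes k: "1 \<le> k" "k < n" and \<sigma>: "\<sigma> permutes {1..n}" and sep: "separated (k + 2) n \<sigma>"
  shows "prolific k n \<sigma>"
proof -
  define r where "r = n - k"
  have n: "n = r + k" using k by (simp add: r_def)
  define occ where "occ \<pi> f \<longleftrightarrow> strict_mono_on {1..r} f \<and> f ` {1..r} \<subseteq> {1..n} \<and>
    (\<forall>i\<in>{1..r}. \<forall>j\<in>{1..r}. \<sigma> (f i) < \<sigma> (f j) \<longleftrightarrow> \<pi> i < \<pi> j)" for \<pi> f :: "nat \<Rightarrow> nat"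
  define P where "P = {\<pi>. \<pi> permutes {1..r} \<and> contains_pattern n \<sigma> r \<pi>}"
  define F where "F \<pi> = (SOME f. occ \<pi> f)" for \<pi>
  have F: "occ \<pi> (F \<pi>)" if "\<pi> \<in> P" for \<pi>
    using that someI_ex[of "occ \<pi>"] by (simp add: P_def contains_pattern_def occ_def F_def)
  have "bij_betw (\<lambda>\<pi>. F \<pi> ` {1..r}) P {S. S \<subseteq> {1..n} \<and> card S = r}"
    unfolding bij_betw_def
  proof
    show "inj_on (\<lambda>\<pi>. F \<pi> ` {1..r}) P"
    proof (rule inj_onI)
      fix \<pi> \<rho> assume P: "\<pi> \<in> P" "\<rho> \<in> P" and eq: "F \<pi> ` {1..r} = F \<rho> ` {1..r}"
      have "F \<pi> i = F \<rho> i" if "i \<in> {1..r}" for i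
        using strict_mono_on_same_image[OF _ _ eq that] F P by (auto simp: occ_def)
      then have "\<pi> i < \<pi> j \<longleftrightarrow> \<rho> i < \<rho> j" if "i \<in> {1..r}" "j \<in> {1..r}" for i j
        using F[OF P(1)] F[OF P(2)] that unfolding occ_def by metis
      then show "\<pi> = \<rho>"
        using P by (intro permutes_eq_if_order_isomorphic) (auto simp: P_def)
    qed
    show "(\<lambda>\<pi>. F \<pi> ` {1..r}) ` P = {S. S \<subseteq> {1..n} \<and> card S = r}"
    proof
      show "(\<lambda>\<pi>. F \<pi> ` {1..r}) ` P \<subseteq> {S. S \<subseteq> {1..n} \<and> card S = r}"
      proof
        fix S assume "S \<in> (\<lambda>\<pi>. F \<pi> ` {1..r}) ` P"
        then obtain \<pi> where "S = F \<pi> ` {1..r}" "occ \<pi> (F \<pi>)" using F by blast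
        then show "S \<in> {S. S \<subseteq> {1..n} \<and> card S = r}"
          using card_image[OF strict_mono_on_imp_inj_on, of "{1..r}" "F \<pi>"] by (simp add: occ_def)
      qed
      show "{S. S \<subseteq> {1..n} \<and> card S = r} \<subseteq> (\<lambda>\<pi>. F \<pi> ` {1..r}) ` P"
      proof
        fix S assume "S \<in> {S. S \<subseteq> {1..n} \<and> card S = r}"
        then have S: "S \<subseteq> {1..n}" "card S = r" by auto
        obtain f \<pi> where f: "strict_mono_on {1..r} f" "f ` {1..r} = S" and \<pi>: "\<pi> permutes {1..r}"
          and iso: "\<And>i j. i \<in> {1..r} \<Longrightarrow> j \<in> {1..r} \<Longrightarrow> \<sigma> (f i) < \<sigma> (f j) \<longleftrightarrow> \<pi> i < \<pi> j"
          using exists_pattern_at[OF \<sigma> S] by metis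
        have "occ \<pi> f" using f iso S by (auto simp: occ_def)
        then have "\<pi> \<in> P" using \<pi> by (auto simp: P_def contains_pattern_def occ_def)
        then have "occ \<pi> (F \<pi>)" by (rule F)
        \<comment> \<open>The occurrence chosen for \<open>\<pi>\<close> need not be
          \<open>f\<close>, but separation forces the same index set.\<close>
        with \<open>occ \<pi> f\<close> have "f ` {1..r} = F \<pi> ` {1..r}"
          unfolding occ_def by (intro separated_occurrence_unique[OF \<sigma> sep n]) auto
        then show "S \<in> (\<lambda>\<pi>. F \<pi> ` {1..r}) ` P" using \<open>\<pi> \<in> P\<close> f(2) by blast
      qed
    qed
  qed
  then have "card P = n choose r"
    using bij_betw_same_card n_subsets[of "{1..n}" r] by fastforce
  also have "\<dots> = n choose k"
    using k binomial_symmetric[of k n] by (simp add: r_def)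
  finally show ?thesis
    using k \<sigma> by (simp add: prolific_def P_def r_def)
qed

theorem theorem4p5:
  fixes k n :: nat
  assumes "k \<ge> 1"
    and "int n \<ge> \<lceil>(real k)\<^sup>2 / 2 + 2 * real k + 1\<rceil>"
  shows "\<exists>\<sigma>. \<sigma> permutes {1..n} \<and> prolific k n \<sigma>"
proof -
  define e where "e = k div 2 + 1"
  have real: "(real k)\<^sup>2 / 2 + 2 * real k + 1 \<le> real n"
    using assms(2) unfolding ceiling_le_iff by simp
  have "real (k * k + 4 * k + 2) \<le> real (2 * n)"
    using real by (simp add: power2_eq_square field_simps)
  then have sq: "k * k + 4 * k + 2 \<le> 2 * n"
    by (simp only: of_nat_le_iff)
  \<comment> \<open>The left-hand side equals the ceiling in the hypothesis for both parities. For
    odd \<open>k\<close>, \<open>sq\<close> compares an odd number with the even number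
    \<open>2 * n\<close>, which supplies the rounding.\<close>
  have "(2 * e + 1) * (k + 2 - e - 1) + e \<le> n"
  proof (cases "even k")
    case True
    then obtain m where "k = 2 * m" by blast
    then show ?thesis using sq by (simp add: e_def algebra_simps)
  next
    case False
    then obtain m where "k = 2 * m + 1" by (blast elim: oddE)
    then show ?thesis using sq by (simp add: e_def algebra_simps)
  qed
  moreover have "2 * e \<le> k + 2" "k + 2 \<le> 2 * e + 1" "1 \<le> e" "e + 2 \<le> k + 2"
    using assms(1) by (auto simp: e_def)
  ultimately obtain \<sigma> where "\<sigma> permutes {1..n}" "separated (k + 2) n \<sigma>"
    using exists_separated_permutation by blast
  moreover have "k < n" using sq by simp
  ultimately show ?thesis
    using separated_imp_prolific assms(1) by blast
qed

end
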